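(* Let $G$ be a countable discrete amenable group, $(V,\|\cdot\|)$ a complete semi-normed (real) vector space, $\pi: G \to \mathrm{Isom}(V)$ a uniformly bounded representation, and $\varphi \in \mathcal{M}$ a set map. If $$\inf_{v \in V} \limsup_{F \to G} \left\|\frac{\varphi(F)}{|F|}-A_F v\right\| = 0,$$ then there exists $v \in V$ such that $$\lim_{F \to G} \left\|\frac{\varphi(F)}{|F|}-A_F v\right\| = 0.$$
   Context: $\mathcal{F}(G)$ is the set of non-empty finite subsets of $G$. For $K\in\mathcal{F}(G)$ and $\delta>0$, a set $F\in\mathcal{F}(G)$ is $(K,\delta)$-invariant if $|KF\,\Delta\, F|\le \delta|F|$; $G$ is amenable if a $(K,\delta)$-invariant set exists for every $(K,\delta)\in\mathcal{F}(G)\times\mathbb{R}_{>0}$. For $\rho:\mathcal{F}(G)\to\mathbb{R}$ and $L\in\mathbb{R}$, $\lim_{F\to G}\rho(F)=L$ means: for every $\epsilon>0$ there is $(K,\delta)\in\mathcal{F}(G)\times\mathbb{R}_{>0}$ such that $|\rho(F)-L|<\epsilon$ for every $(K,\delta)$-invariant $F$. Also $\limsup_{F\to G}\rho(F):=\inf_{(K,\delta)}\sup\{\rho(F): F \text{ is } (K,\delta)\text{-invariant}\}$. $V$ is complete: every $\|\cdot\|$-Cauchy sequence has a $\|\cdot\|$-limit in $V$. $\mathrm{Isom}(V)$ denotes the group of bounded invertible linear operators on $V$ (not necessarily isometries); a representation is a group homomorphism $\pi:G\to\mathrm{Isom}(V)$; it is uniformly bounded if $C_\pi:=\sup_{g\in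 G}\|\pi(g)\|_{\mathrm{op}}<\infty$. For $F\in\mathcal{F}(G)$ and $v\in V$, $A_Fv=\frac1{|F|}\sum_{g\in F}\pi(g^{-1})v$. A set map is a function $\varphi:\mathcal{F}(G)\to V$. It is $G$-equivariant if $\pi(g)\varphi(F)=\varphi(Fg^{-1})$ for all $g\in G$, $F\in\mathcal{F}(G)$, and bounded if $\sup_{F\in\mathcal{F}(G)}\|\varphi(F)/|F|\|<\infty$. $\mathcal{M}$ is the space of bounded and $G$-equivariant set maps. *)

theory Defs
  imports Complex_Main "HOL-Library.Extended_Real" "HOL-Algebra.Coset"
begin

section \<open>Invariant sets, amenability and limits along invariant sets\<close>

definition fin_sets :: "('g, 'm) monoid_scheme \<Rightarrow> 'g set set"
  where "fin_sets G = {F. F \<subseteq> carrier G \<and> finite F \<and> F \<noteq> {}}"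

definition invariant_set ::
    "('g, 'm) monoid_scheme \<Rightarrow> 'g set \<Rightarrow> real \<Rightarrow> 'g set \<Rightarrow> bool"
  where "invariant_set G K \<delta> F \<longleftrightarrow>
    F \<in> fin_sets G \<and> real (card (sym_diff (K <#>\<^bsub>G\<^esub> F) F)) \<le> \<delta> * real (card F)"

definition amenable :: "('g, 'm) monoid_scheme \<Rightarrow> bool"
  where "amenable G \<longleftrightarrow> (\<forall>K\<in>fin_sets G. \<forall>\<delta>>0. \<exists>F. invariant_set G K \<delta> F)"

definition tends_along ::
    "('g, 'm) monoid_scheme \<Rightarrow> ('g set \<Rightarrow> real) \<Rightarrow> real \<Rightarrow> bool"
  where "tends_along G \<rho> L \<longleftrightarrow>
    (\<forall>\<epsilon>>0. \<exists>K\<in>fin_sets G. \<exists>\<delta>>0. \<forall>F. invariant_set G K \<delta> F \<longrightarrow> \<bar>\<rho> F - L\<bar> < \<epsilon>)"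

text \<open>The upper limit is taken in the extended reals: for a real-valued \<open>\<rho>\<close> the suprema
  may be infinite, and \<open>Sup\<close> on \<^typ>\<open>real\<close> is unspecified on unbounded sets.\<close>

definition limsup_along ::
    "('g, 'm) monoid_scheme \<Rightarrow> ('g set \<Rightarrow> real) \<Rightarrow> ereal"
  where "limsup_along G \<rho> =
    (INF (K, \<delta>) \<in> fin_sets G \<times> {0<..}. SUP F \<in> {F. invariant_set G K \<delta> F}. ereal (\<rho> F))"


section \<open>Complete semi-normed spaces and their bounded invertible operators\<close>

text \<open>Nonnegativity of a seminorm and \<open>p 0 = 0\<close> follow from the two clauses.\<close>

definition seminorm :: "('v::real_vector \<Rightarrow> real) \<Rightarrow> bool"
  where "seminorm p \<longleftrightarrow>
    (\<forall>x y. p (x + y) \<le> p x + p y) \<and> (\<forall>c x. p (c *\<^sub>R x) = \<bar>c\<bar> * p x)"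

definition complete_seminorm :: "('v::real_vector \<Rightarrow> real) \<Rightarrow> bool"
  where "complete_seminorm p \<longleftrightarrow>
    (\<forall>X :: nat \<Rightarrow> 'v. (\<forall>\<epsilon>>0. \<exists>N. \<forall>m\<ge>N. \<forall>n\<ge>N. p (X m - X n) < \<epsilon>) \<longrightarrow>
      (\<exists>x. (\<lambda>n. p (X n - x)) \<longlonglongrightarrow> 0))"

definition bounded_op :: "('v::real_vector \<Rightarrow> real) \<Rightarrow> ('v \<Rightarrow> 'v) \<Rightarrow> bool"
  where "bounded_op p T \<longleftrightarrow> linear T \<and> (\<exists>C. \<forall>v. p (T v) \<le> C * p v)"

definition op_norm :: "('v::real_vector \<Rightarrow> real) \<Rightarrow> ('v \<Rightarrow> 'v) \<Rightarrow> real"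
  where "op_norm p T = (SUP v\<in>{v. p v \<le> 1}. p (T v))"

text \<open>Boundedness of the inverse is required explicitly: it is needed for a group, and for a
  seminorm with nontrivial kernel it does not follow from completeness.\<close>

definition Isom :: "('v::real_vector \<Rightarrow> real) \<Rightarrow> ('v \<Rightarrow> 'v) monoid"
  where "Isom p =
    \<lparr>carrier = {T. bounded_op p T \<and> bij T \<and> bounded_op p (inv_into UNIV T)},
     mult = (\<circ>), one = id\<rparr>"

lemma seminorm_nonneg:
  assumes "seminorm p"
  shows "0 \<le> p x"
proof -
  have "p (0 *\<^sub>R x) = \<bar>0\<bar> * p x" and neg: "p ((-1) *\<^sub>R x) = \<bar>-1\<bar> * p x"
    using assms unfolding seminorm_def by blast+
  moreover have "p (x + (-1) *\<^sub>R x) \<le> p x + p ((-1) *\<^sub>R x)"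
    using assms unfolding seminorm_def by blast
  ultimately show ?thesis by simp
qed

lemma bounded_op_comp:
  assumes "seminorm p" "bounded_op p S" "bounded_op p T"
  shows "bounded_op p (S \<circ> T)"
proof -
  obtain C D where C: "\<And>v. p (S v) \<le> C * p v" and D: "\<And>v. p (T v) \<le> D * p v"
    using assms(2,3) unfolding bounded_op_def by blast
  have "p (S (T v)) \<le> \<bar>C\<bar> * D * p v" for v
  proof -
    have "p (S (T v)) \<le> C * p (T v)" by (rule C)
    also have "\<dots> \<le> \<bar>C\<bar> * p (T v)"
      by (rule mult_right_mono) (use seminorm_nonneg[OF assms(1)] in auto)
    also have "\<dots> \<le> \<bar>C\<bar> * (D * p v)" by (rule mult_left_mono) (use D in auto)
    finally show ?thesis by (simp add: mult.assoc)
  qed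
  moreover have "linear (S \<circ> T)"
    using assms(2,3) unfolding bounded_op_def by (blast intro: linear_compose)
  ultimately show ?thesis unfolding bounded_op_def by auto
qed

lemma group_Isom:
  assumes "seminorm p"
  shows "group (Isom p)"
proof (rule groupI)
  fix S T assume "S \<in> carrier (Isom p)" "T \<in> carrier (Isom p)"
  then show "S \<otimes>\<^bsub>Isom p\<^esub> T \<in> carrier (Isom p)"
    using bounded_op_comp[OF assms] by (auto simp: Isom_def o_inv_distrib bij_comp)
next
  have "bounded_op p id"
    unfolding bounded_op_def by (auto intro: exI[of _ 1] simp: linear_iff)
  then show "\<one>\<^bsub>Isom p\<^esub> \<in> carrier (Isom p)" by (simp add: Isom_def)
next
  fix T assume T: "T \<in> carrier (Isom p)"
  then have "inv_into UNIV T \<in> carrier (Isom p)"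
    by (auto simp: Isom_def inv_inv_eq bij_imp_bij_inv)
  moreover have "inv_into UNIV T \<circ> T = id"
    using T by (auto simp: Isom_def bij_is_inj)
  ultimately show "\<exists>S\<in>carrier (Isom p). S \<otimes>\<^bsub>Isom p\<^esub> T = \<one>\<^bsub>Isom p\<^esub>"
    by (auto simp: Isom_def)
qed (auto simp: Isom_def comp_assoc)


section \<open>Representations, averages and set maps\<close>

definition is_representation ::
    "('g, 'm) monoid_scheme \<Rightarrow> ('v::real_vector \<Rightarrow> real) \<Rightarrow> ('g \<Rightarrow> 'v \<Rightarrow> 'v) \<Rightarrow> bool"
  where "is_representation G p \<pi> \<longleftrightarrow> \<pi> \<in> hom G (Isom p)"

definition uniformly_bounded ::
    "('g, 'm) monoid_scheme \<Rightarrow> ('v::real_vector \<Rightarrow> real) \<Rightarrow> ('g \<Rightarrow> 'v \<Rightarrow> 'v) \<Rightarrow> bool"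
  where "uniformly_bounded G p \<pi> \<longleftrightarrow> bdd_above ((\<lambda>g. op_norm p (\<pi> g)) ` carrier G)"

definition average ::
    "('g, 'm) monoid_scheme \<Rightarrow> ('g \<Rightarrow> 'v::real_vector \<Rightarrow> 'v) \<Rightarrow> 'g set \<Rightarrow> 'v \<Rightarrow> 'v"
  where "average G \<pi> F v = (1 / real (card F)) *\<^sub>R (\<Sum>g\<in>F. \<pi> (inv\<^bsub>G\<^esub> g) v)"

text \<open>A set map is only meaningful on \<^term>\<open>fin_sets G\<close>; its values on other sets are
  never used.\<close>

definition equivariant_set_map ::
    "('g, 'm) monoid_scheme \<Rightarrow> ('g \<Rightarrow> 'v::real_vector \<Rightarrow> 'v) \<Rightarrow> ('g set \<Rightarrow> 'v) \<Rightarrow> bool"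
  where "equivariant_set_map G \<pi> \<phi> \<longleftrightarrow>
    (\<forall>g\<in>carrier G. \<forall>F\<in>fin_sets G. \<pi> g (\<phi> F) = \<phi> (F #>\<^bsub>G\<^esub> inv\<^bsub>G\<^esub> g))"

definition bounded_set_map ::
    "('g, 'm) monoid_scheme \<Rightarrow> ('v::real_vector \<Rightarrow> real) \<Rightarrow> ('g set \<Rightarrow> 'v) \<Rightarrow> bool"
  where "bounded_set_map G p \<phi> \<longleftrightarrow>
    bdd_above ((\<lambda>F. p ((1 / real (card F)) *\<^sub>R \<phi> F)) ` fin_sets G)"

definition set_maps ::
    "('g, 'm) monoid_scheme \<Rightarrow> ('v::real_vector \<Rightarrow> real) \<Rightarrow> ('g \<Rightarrow> 'v \<Rightarrow> 'v) \<Rightarrow> ('g set \<Rightarrow> 'v) set"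
  where "set_maps G p \<pi> = {\<phi>. bounded_set_map G p \<phi> \<and> equivariant_set_map G \<pi> \<phi>}"

end

theory Submission
  imports Defs
begin

text \<open>
  Write \<open>N v F\<close> for the seminorm of \<open>\<phi> F / |F| - A\<^sub>F v\<close>.  The hypothesis provides vectors \<open>v\<close>
  for which \<open>N v\<close> is eventually as small as desired, but these vectors need not converge.  The
  point of the proof is that they can be replaced by equally good ones that do.

  Averaging over a fixed finite set is invisible in the limit: for every \<open>u\<close> and every finite
  \<open>E\<close>, the averages \<open>A\<^sub>F (u - A\<^sub>E u)\<close> tend to zero, because translating \<open>F\<close> by an element of \<open>E\<close>
  changes only a small part of \<open>F\<close> (\<open>average_minus_average_tendsto_0\<close>).  Now let \<open>w\<close> and \<open>v\<close> be
  vectors with \<open>N w\<close> eventually below \<open>a\<close> and \<open>N v\<close> eventually below \<open>b\<close>.  Then \<open>A\<^sub>F (v - w)\<close>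
  eventually has seminorm below \<open>a + b\<close>, although \<open>v - w\<close> itself may be large.  By amenability
  there is a finite set \<open>E\<close> where this bound holds, and \<open>w' = w + A\<^sub>E (v - w)\<close> is within \<open>a + b\<close>
  of \<open>w\<close> while approximating \<open>\<phi>\<close> as well as \<open>v\<close> does, since
  \<open>v - w' = (v - w) - A\<^sub>E (v - w)\<close> has vanishing averages (\<open>nearby_better_approximation\<close>).

  Iterating with errors \<open>2\<^sup>-\<^sup>n\<close> gives a Cauchy sequence.  All averaging operators are bounded by
  the bound of the representation, so its limit has error tending to zero
  (\<open>exists_exact_approximation\<close>).
\<close>

section \<open>Limits along invariant sets as filter limits\<close>

definition invariance_filter :: "('g, 'm) monoid_scheme \<Rightarrow> 'g set filter"
  where "invariance_filter G =
    (INF (K, \<delta>) \<in> fin_sets G \<times> {0<..}. principal {F. invariant_set G K \<delta> F})"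

lemma card_left_translate:
  assumes "group G" "g \<in> carrier G" "F \<subseteq> carrier G"
  shows "{g} <#>\<^bsub>G\<^esub> F = (\<lambda>h. g \<otimes>\<^bsub>G\<^esub> h) ` F"
    and "inj_on (\<lambda>h. g \<otimes>\<^bsub>G\<^esub> h) F"
    and "card ({g} <#>\<^bsub>G\<^esub> F) = card F"
proof -
  interpret group G by (fact assms(1))
  show *: "{g} <#>\<^bsub>G\<^esub> F = (\<lambda>h. g \<otimes>\<^bsub>G\<^esub> h) ` F"
    by (auto simp: set_mult_def)
  show inj: "inj_on (\<lambda>h. g \<otimes>\<^bsub>G\<^esub> h) F"
    using assms(2,3) by (auto simp: inj_on_def subset_iff)
  show "card ({g} <#>\<^bsub>G\<^esub> F) = card F"
    unfolding * by (rule card_image[OF inj])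
qed

text \<open>Shrinking \<open>K\<close> makes \<open>KF - F\<close> smaller but may make \<open>F - KF\<close> larger.  The latter is still
  controlled, because \<open>F - KF \<subseteq> F - kF\<close> for any \<open>k \<in> K\<close> and \<open>|F - kF| = |kF - F|\<close>.  This costs
  a factor of two.\<close>

lemma invariant_set_mono:
  assumes "group G" "K \<in> fin_sets G" "K \<subseteq> L" "L \<in> fin_sets G" "2 * \<delta> \<le> \<epsilon>"
    and inv: "invariant_set G L \<delta> F"
  shows "invariant_set G K \<epsilon> F"
proof -
  interpret group G by (fact assms(1))
  have F: "F \<subseteq> carrier G" "finite F" "F \<in> fin_sets G"
    and le: "real (card (sym_diff (L <#>\<^bsub>G\<^esub> F) F)) \<le> \<delta> * real (card F)"
    using inv by (auto simp: invariant_set_def fin_sets_def)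
  obtain k where k: "k \<in> K" "k \<in> carrier G"
    using assms(2) by (auto simp: fin_sets_def)
  have fin: "finite (M <#>\<^bsub>G\<^esub> F)" if "M \<in> fin_sets G" for M
    using that F(2) by (auto simp: set_mult_def fin_sets_def)
  have fin_k: "finite ({k} <#>\<^bsub>G\<^esub> F)"
    using fin[of "{k}"] k(2) by (simp add: fin_sets_def)
  have sub: "{k} <#>\<^bsub>G\<^esub> F \<subseteq> K <#>\<^bsub>G\<^esub> F" "K <#>\<^bsub>G\<^esub> F \<subseteq> L <#>\<^bsub>G\<^esub> F"
    using k assms(3) by (auto simp: set_mult_def)
  have finL: "finite (sym_diff (L <#>\<^bsub>G\<^esub> F) F)"
    using fin[OF assms(4)] F(2) by simp
  have "card (F - (K <#>\<^bsub>G\<^esub> F)) \<le> card (F - ({k} <#>\<^bsub>G\<^esub> F))"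
    using sub F(2) by (intro card_mono) auto
  also have "\<dots> = card (({k} <#>\<^bsub>G\<^esub> F) - F)"
    using card_left_translate(3)[OF assms(1) k(2) F(1)]
    using card_Diff_subset_Int[of F "{k} <#>\<^bsub>G\<^esub> F"] card_Diff_subset_Int[of "{k} <#>\<^bsub>G\<^esub> F" F] F(2) fin_k
    by (simp add: Int_commute)
  also have "\<dots> \<le> card (sym_diff (L <#>\<^bsub>G\<^esub> F) F)"
    using sub finL by (intro card_mono) auto
  finally have 1: "card (F - (K <#>\<^bsub>G\<^esub> F)) \<le> card (sym_diff (L <#>\<^bsub>G\<^esub> F) F)" .
  have 2: "card ((K <#>\<^bsub>G\<^esub> F) - F) \<le> card (sym_diff (L <#>\<^bsub>G\<^esub> F) F)"
    using sub finL by (intro card_mono) auto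
  have "card (sym_diff (K <#>\<^bsub>G\<^esub> F) F) \<le> card ((K <#>\<^bsub>G\<^esub> F) - F) + card (F - (K <#>\<^bsub>G\<^esub> F))"
    by (rule card_Un_le)
  with 1 2 le have "real (card (sym_diff (K <#>\<^bsub>G\<^esub> F) F)) \<le> (2 * \<delta>) * real (card F)"
    by linarith
  also have "\<dots> \<le> \<epsilon> * real (card F)"
    by (intro mult_right_mono assms) auto
  finally show ?thesis
    using F(3) by (simp add: invariant_set_def)
qed

text \<open>The infimum is directed: by the previous lemma, sufficiently \<open>(K \<union> L)\<close>-invariant sets are
  both \<open>(K, \<delta>)\<close>- and \<open>(L, \<epsilon>)\<close>-invariant, so a single pair witnesses every eventual property.\<close>

lemma eventually_invariance_filter:
  assumes "group G"
  shows "eventually P (invariance_filter G) \<longleftrightarrow>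
    (\<exists>K\<in>fin_sets G. \<exists>\<delta>>0. \<forall>F. invariant_set G K \<delta> F \<longrightarrow> P F)"
proof -
  interpret group G by (fact assms)
  let ?I = "fin_sets G \<times> {0::real<..}"
  have "({\<one>\<^bsub>G\<^esub>}, 1) \<in> ?I"
    by (auto simp: fin_sets_def)
  then have ne: "?I \<noteq> {}" by blast
  have directed: "\<exists>z\<in>?I. (case z of (K, \<delta>) \<Rightarrow> principal {F. invariant_set G K \<delta> F})
      \<le> inf (case x of (K, \<delta>) \<Rightarrow> principal {F. invariant_set G K \<delta> F})
          (case y of (K, \<delta>) \<Rightarrow> principal {F. invariant_set G K \<delta> F})"
    if "x \<in> ?I" "y \<in> ?I" for x y
  proof -
    obtain K \<delta> L \<epsilon> where xy: "x = (K, \<delta>)" "y = (L, \<epsilon>)"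
      by (cases x, cases y)
    have KL: "K \<union> L \<in> fin_sets G" "K \<in> fin_sets G" "L \<in> fin_sets G" "\<delta> > 0" "\<epsilon> > 0"
      using that unfolding xy by (auto simp: fin_sets_def)
    let ?m = "min \<delta> \<epsilon> / 2"
    have "invariant_set G K \<delta> F \<and> invariant_set G L \<epsilon> F"
      if "invariant_set G (K \<union> L) ?m F" for F
      using invariant_set_mono[OF assms KL(2) _ KL(1) _ that, of \<delta>]
        invariant_set_mono[OF assms KL(3) _ KL(1) _ that, of \<epsilon>] by auto
    then show ?thesis
      unfolding xy using KL by (intro bexI[of _ "(K \<union> L, ?m)"]) auto
  qed
  show ?thesis
    unfolding invariance_filter_def
    by (subst eventually_INF_base[OF ne directed]) (auto simp: eventually_principal Bex_def)
qed

lemma tends_along_iff_tendsto: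
  assumes "group G"
  shows "tends_along G \<rho> L \<longleftrightarrow> (\<rho> \<longlongrightarrow> L) (invariance_filter G)"
  by (simp add: tends_along_def tendsto_iff eventually_invariance_filter[OF assms] dist_real_def)

lemma limsup_along_less_imp_eventually:
  assumes "group G" "limsup_along G \<rho> < ereal c"
  shows "eventually (\<lambda>F. \<rho> F < c) (invariance_filter G)"
proof -
  obtain K \<delta> where K: "K \<in> fin_sets G" "\<delta> > 0"
    and less: "(SUP F \<in> {F. invariant_set G K \<delta> F}. ereal (\<rho> F)) < ereal c"
    using assms(2) unfolding limsup_along_def INF_less_iff by auto
  have "\<rho> F < c" if "invariant_set G K \<delta> F" for F
  proof -
    have "ereal (\<rho> F) \<le> (SUP F \<in> {F. invariant_set G K \<delta> F}. ereal (\<rho> F))"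
      using that by (intro SUP_upper) simp
    with less have "ereal (\<rho> F) < ereal c" by (rule le_less_trans[rotated])
    then show ?thesis by simp
  qed
  with K show ?thesis
    unfolding eventually_invariance_filter[OF assms(1)] by blast
qed

lemma invariance_filter_neq_bot:
  assumes "group G" "amenable G"
  shows "invariance_filter G \<noteq> bot"
  using assms(2) unfolding trivial_limit_def eventually_invariance_filter[OF assms(1)] amenable_def
  by blast

lemma eventually_fin_sets:
  assumes "group G"
  shows "eventually (\<lambda>F. F \<in> fin_sets G) (invariance_filter G)"
proof -
  interpret group G by (fact assms)
  have "{\<one>\<^bsub>G\<^esub>} \<in> fin_sets G" by (simp add: fin_sets_def)
  then show ?thesis
    unfolding eventually_invariance_filter[OF assms] invariant_set_def
    by (intro bexI[of _ "{\<one>\<^bsub>G\<^esub>}"] exI[of _ 1]) auto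
qed

lemma translation_defect_tendsto_0:
  assumes "group G" "g \<in> carrier G"
  shows "((\<lambda>F. real (card (sym_diff ({g} <#>\<^bsub>G\<^esub> F) F)) / real (card F)) \<longlongrightarrow> 0)
    (invariance_filter G)"
  unfolding tendsto_iff
proof (intro allI impI)
  fix \<epsilon> :: real assume "\<epsilon> > 0"
  have "dist (real (card (sym_diff ({g} <#>\<^bsub>G\<^esub> F) F)) / real (card F)) 0 < \<epsilon>"
    if "invariant_set G {g} (\<epsilon> / 2) F" for F
  proof -
    have "card F > 0"
      and le: "real (card (sym_diff ({g} <#>\<^bsub>G\<^esub> F) F)) \<le> \<epsilon> / 2 * real (card F)"
      using that by (auto simp: invariant_set_def fin_sets_def card_gt_0_iff)
    then have "real (card (sym_diff ({g} <#>\<^bsub>G\<^esub> F) F)) / real (card F) \<le> \<epsilon> / 2"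
      by (simp add: divide_le_eq)
    also have "\<dots> < \<epsilon>" using \<open>\<epsilon> > 0\<close> by simp
    finally show ?thesis by simp
  qed
  then show "eventually (\<lambda>F. dist (real (card (sym_diff ({g} <#>\<^bsub>G\<^esub> F) F)) / real (card F)) 0 < \<epsilon>)
    (invariance_filter G)"
    unfolding eventually_invariance_filter[OF assms(1)]
    using assms(2) \<open>\<epsilon> > 0\<close> by (intro bexI[of _ "{g}"] exI[of _ "\<epsilon> / 2"]) (auto simp: fin_sets_def)
qed

section \<open>Seminorms and operator bounds\<close>

lemma seminorm_triangle: "seminorm p \<Longrightarrow> p (x + y) \<le> p x + p y"
  by (simp add: seminorm_def)

lemma seminorm_scaleR: "seminorm p \<Longrightarrow> p (c *\<^sub>R x) = \<bar>c\<bar> * p x"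
  by (simp add: seminorm_def)

lemma seminorm_zero: "seminorm p \<Longrightarrow> p 0 = 0"
  using seminorm_scaleR[of p 0 0] by simp

lemma seminorm_minus_commute: "seminorm p \<Longrightarrow> p (x - y) = p (y - x)"
  using seminorm_scaleR[of p "-1" "x - y"] by simp

lemma seminorm_triangle_diff: "seminorm p \<Longrightarrow> p (x - z) \<le> p (x - y) + p (y - z)"
  using seminorm_triangle[of p "x - y" "y - z"] by simp

lemma seminorm_diff_le: "seminorm p \<Longrightarrow> p (x - y) \<le> p x + p y"
  using seminorm_triangle_diff[of p x y 0] seminorm_minus_commute[of p 0 y] by simp

lemma seminorm_sum_le:
  assumes "seminorm p"
  shows "p (sum f A) \<le> (\<Sum>x\<in>A. p (f x))"
proof (induction A rule: infinite_finite_induct)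
  case (insert x A)
  then show ?case
    using seminorm_triangle[OF assms, of "f x" "sum f A"] by simp
qed (simp_all add: seminorm_zero[OF assms])

lemma seminorm_op_norm_bound:
  assumes p: "seminorm p" and T: "bounded_op p T"
  shows "p (T v) \<le> op_norm p T * p v"
proof -
  obtain C where C: "\<And>v. p (T v) \<le> C * p v"
    using T by (auto simp: bounded_op_def)
  show ?thesis
  proof (cases "p v = 0")
    \<comment> \<open>Rescaling \<open>v\<close> to seminorm one is impossible here.\<close>
    case True
    then show ?thesis using C[of v] by simp
  next
    case False
    then have pos: "p v > 0" using seminorm_nonneg[OF p, of v] by simp
    have "p (T x) \<le> \<bar>C\<bar>" if "p x \<le> 1" for x
    proof -
      have "p (T x) \<le> C * p x" by (rule C)
      also have "\<dots> \<le> \<bar>C\<bar> * p x"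
        using seminorm_nonneg[OF p, of x] by (intro mult_right_mono) auto
      also have "\<dots> \<le> \<bar>C\<bar>" using that by (simp add: mult_left_le)
      finally show ?thesis .
    qed
    then have bdd: "bdd_above ((\<lambda>v. p (T v)) ` {v. p v \<le> 1})"
      by (intro bdd_aboveI[of _ "\<bar>C\<bar>"]) auto
    have "p (T ((1 / p v) *\<^sub>R v)) \<le> op_norm p T"
      unfolding op_norm_def
      using pos by (intro cSUP_upper bdd) (simp add: seminorm_scaleR[OF p])
    moreover have "T ((1 / p v) *\<^sub>R v) = (1 / p v) *\<^sub>R T v"
      using T by (simp add: bounded_op_def linear_scale)
    ultimately show ?thesis
      using pos by (simp add: seminorm_scaleR[OF p] divide_le_eq)
  qed
qed

lemma uniformly_bounded_obtain:
  assumes p: "seminorm p" and rep: "is_representation G p \<pi>" and ub: "uniformly_bounded G p \<pi>"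
  obtains C where "C \<ge> 0" "\<And>g v. g \<in> carrier G \<Longrightarrow> p (\<pi> g v) \<le> C * p v"
proof -
  obtain B where B: "\<And>g. g \<in> carrier G \<Longrightarrow> op_norm p (\<pi> g) \<le> B"
    using ub by (auto simp: uniformly_bounded_def bdd_above_def)
  have "p (\<pi> g v) \<le> \<bar>B\<bar> * p v" if g: "g \<in> carrier G" for g v
  proof -
    have "bounded_op p (\<pi> g)"
      using rep g by (auto simp: is_representation_def hom_def Isom_def)
    then have "p (\<pi> g v) \<le> op_norm p (\<pi> g) * p v"
      by (rule seminorm_op_norm_bound[OF p])
    also have "\<dots> \<le> \<bar>B\<bar> * p v"
      using B[OF g] seminorm_nonneg[OF p] by (intro mult_right_mono) auto
    finally show ?thesis .
  qed
  then show thesis using that[of "\<bar>B\<bar>"] by simp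
qed

section \<open>Averages of a uniformly bounded representation\<close>

locale bounded_representation = group G
  for G :: "('g, 'm) monoid_scheme" (structure) +
  fixes p :: "'v::real_vector \<Rightarrow> real" and \<pi> :: "'g \<Rightarrow> 'v \<Rightarrow> 'v" and C :: real
  assumes seminorm: "seminorm p"
    and linear: "g \<in> carrier G \<Longrightarrow> linear (\<pi> g)"
    and mult: "\<lbrakk>g \<in> carrier G; h \<in> carrier G\<rbrakk> \<Longrightarrow> \<pi> (g \<otimes> h) v = \<pi> g (\<pi> h v)"
    and bound_nonneg: "C \<ge> 0"
    and bound: "g \<in> carrier G \<Longrightarrow> p (\<pi> g v) \<le> C * p v"
begin

lemma linear_average:
  assumes "F \<in> fin_sets G"
  shows "linear (average G \<pi> F)"
proof -
  have "linear (\<pi> (inv g))" if "g \<in> F" for g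
    using that assms by (intro linear) (auto simp: fin_sets_def)
  then show ?thesis
    unfolding average_def by (intro linear_compose_scale_right linear_compose_sum) auto
qed

lemma average_diff:
  "F \<in> fin_sets G \<Longrightarrow> average G \<pi> F (u - v) = average G \<pi> F u - average G \<pi> F v"
  by (rule linear_diff[OF linear_average])

lemma seminorm_sum_orbit_le:
  assumes "A \<subseteq> carrier G"
  shows "p (\<Sum>g\<in>A. \<pi> (inv g) v) \<le> real (card A) * (C * p v)"
proof -
  have "p (\<Sum>g\<in>A. \<pi> (inv g) v) \<le> (\<Sum>g\<in>A. p (\<pi> (inv g) v))"
    by (rule seminorm_sum_le[OF seminorm])
  also have "\<dots> \<le> (\<Sum>g\<in>A. C * p v)"
    using assms by (intro sum_mono bound) auto
  finally show ?thesis by simp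
qed

lemma seminorm_average_le:
  assumes "F \<in> fin_sets G"
  shows "p (average G \<pi> F v) \<le> C * p v"
proof -
  have F: "F \<subseteq> carrier G" "card F > 0"
    using assms by (auto simp: fin_sets_def card_gt_0_iff)
  then show ?thesis
    using seminorm_sum_orbit_le[OF F(1), of v]
    by (simp add: average_def seminorm_scaleR[OF seminorm] divide_le_eq mult.commute)
qed

text \<open>The average of \<open>\<pi> g\<inverse> u\<close> over \<open>F\<close> is the average of \<open>u\<close> over the translate \<open>gF\<close>, so in the
  difference of the two averages of \<open>u\<close> the terms indexed by \<open>F \<inter> gF\<close> cancel.\<close>

lemma seminorm_average_translate_le:
  assumes F: "F \<in> fin_sets G" and g: "g \<in> carrier G"
  shows "p (average G \<pi> F (u - \<pi> (inv g) u))
    \<le> C * p u * (real (card (sym_diff ({g} <#> F) F)) / real (card F))"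
proof -
  let ?gF = "{g} <#> F" and ?s = "\<lambda>h. \<pi> (inv h) u"
  have F': "F \<subseteq> carrier G" "finite F" "card F > 0"
    using F by (auto simp: fin_sets_def card_gt_0_iff)
  note tr = card_left_translate[OF is_group g F'(1)]
  have gF: "?gF \<subseteq> carrier G" "finite ?gF"
    using F' g by (auto simp: tr(1))
  have "(\<Sum>h\<in>F. \<pi> (inv h) (\<pi> (inv g) u)) = (\<Sum>h\<in>F. ?s (g \<otimes> h))"
    using F' g by (intro sum.cong) (auto simp: mult[symmetric] inv_mult_group subset_iff)
  also have "\<dots> = sum ?s ?gF"
    unfolding tr(1) by (simp add: sum.reindex[OF tr(2)])
  finally have shift: "(\<Sum>h\<in>F. \<pi> (inv h) (\<pi> (inv g) u)) = sum ?s ?gF" .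
  have "sum ?s F - sum ?s ?gF = sum ?s (F - ?gF) - sum ?s (?gF - F)"
    using sum.Int_Diff[OF F'(2), of ?s ?gF] sum.Int_Diff[OF gF(2), of ?s F]
    by (simp add: Int_commute)
  then have "p (sum ?s F - sum ?s ?gF) \<le> p (sum ?s (F - ?gF)) + p (sum ?s (?gF - F))"
    using seminorm_diff_le[OF seminorm] by simp
  also have "\<dots> \<le> real (card (F - ?gF)) * (C * p u) + real (card (?gF - F)) * (C * p u)"
    using F' gF by (intro add_mono seminorm_sum_orbit_le) auto
  also have "\<dots> = real (card (sym_diff ?gF F)) * (C * p u)"
    using F' gF by (subst card_Un_disjoint) (auto simp: algebra_simps)
  finally have "p (sum ?s F - sum ?s ?gF) \<le> real (card (sym_diff ?gF F)) * (C * p u)" .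
  moreover have "average G \<pi> F (u - \<pi> (inv g) u) = (1 / real (card F)) *\<^sub>R (sum ?s F - sum ?s ?gF)"
    unfolding average_diff[OF F] by (simp add: shift[symmetric] average_def scaleR_right_diff_distrib)
  ultimately show ?thesis
    using F'(3) by (simp add: seminorm_scaleR[OF seminorm] divide_right_mono mult.commute)
qed

lemma average_translate_tendsto_0:
  assumes "g \<in> carrier G"
  shows "((\<lambda>F. p (average G \<pi> F (u - \<pi> (inv g) u))) \<longlongrightarrow> 0) (invariance_filter G)"
proof (rule tendsto_sandwich)
  show "eventually (\<lambda>F. 0 \<le> p (average G \<pi> F (u - \<pi> (inv g) u))) (invariance_filter G)"
    by (simp add: seminorm_nonneg[OF seminorm])
  show "eventually (\<lambda>F. p (average G \<pi> F (u - \<pi> (inv g) u))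
      \<le> C * p u * (real (card (sym_diff ({g} <#> F) F)) / real (card F))) (invariance_filter G)"
    using eventually_fin_sets[OF is_group]
    by eventually_elim (rule seminorm_average_translate_le[OF _ assms])
  show "((\<lambda>F. C * p u * (real (card (sym_diff ({g} <#> F) F)) / real (card F))) \<longlongrightarrow> 0)
      (invariance_filter G)"
    by (rule tendsto_mult_right_zero[OF translation_defect_tendsto_0[OF is_group assms]])
qed simp

text \<open>The vector \<open>u - A\<^sub>E u\<close> is the mean of the finitely many differences \<open>u - \<pi> g\<inverse> u\<close> with
  \<open>g \<in> E\<close>, each of which has vanishing averages.\<close>

lemma average_minus_average_tendsto_0:
  assumes E: "E \<in> fin_sets G"
  shows "((\<lambda>F. p (average G \<pi> F (u - average G \<pi> E u))) \<longlongrightarrow> 0) (invariance_filter G)"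
proof (rule tendsto_sandwich)
  have E': "E \<subseteq> carrier G" "finite E" "card E > 0"
    using E by (auto simp: fin_sets_def card_gt_0_iff)
  let ?c = "1 / real (card E)"
  have "u = ?c *\<^sub>R (\<Sum>g\<in>E. u)"
    using E'(3) by (simp add: sum_constant_scaleR)
  then have mean: "u - average G \<pi> E u = ?c *\<^sub>R (\<Sum>g\<in>E. u - \<pi> (inv g) u)"
    by (simp add: average_def sum_subtractf scaleR_right_diff_distrib)
  show "eventually (\<lambda>F. 0 \<le> p (average G \<pi> F (u - average G \<pi> E u))) (invariance_filter G)"
    by (simp add: seminorm_nonneg[OF seminorm])
  show "eventually (\<lambda>F. p (average G \<pi> F (u - average G \<pi> E u))
      \<le> ?c * (\<Sum>g\<in>E. p (average G \<pi> F (u - \<pi> (inv g) u)))) (invariance_filter G)"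
    using eventually_fin_sets[OF is_group]
  proof eventually_elim
    case (elim F)
    have "average G \<pi> F (u - average G \<pi> E u)
        = ?c *\<^sub>R (\<Sum>g\<in>E. average G \<pi> F (u - \<pi> (inv g) u))"
      unfolding mean
      by (simp add: linear_scale[OF linear_average[OF elim]] linear_sum[OF linear_average[OF elim]])
    then show ?case
      using seminorm_sum_le[OF seminorm, of "\<lambda>g. average G \<pi> F (u - \<pi> (inv g) u)" E]
      by (simp add: seminorm_scaleR[OF seminorm] divide_right_mono)
  qed
  show "((\<lambda>F. ?c * (\<Sum>g\<in>E. p (average G \<pi> F (u - \<pi> (inv g) u)))) \<longlongrightarrow> 0) (invariance_filter G)"
    using E'(1) by (intro tendsto_mult_right_zero tendsto_null_sum average_translate_tendsto_0) auto
qed simp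

section \<open>Passing to an exact approximation\<close>

text \<open>The vector \<open>v\<close> itself may be far from \<open>w\<close>.  Only the averages of \<open>v - w\<close> are known to be
  small, so \<open>w\<close> is moved by one such average, whose own averages cannot be distinguished in the
  limit from those of \<open>v - w\<close>.\<close>

lemma nearby_better_approximation:
  fixes \<psi> :: "'g set \<Rightarrow> 'v"
  assumes nontrivial: "invariance_filter G \<noteq> bot"
    and w: "eventually (\<lambda>F. p (\<psi> F - average G \<pi> F w) < a) (invariance_filter G)"
    and v: "eventually (\<lambda>F. p (\<psi> F - average G \<pi> F v) < b / 2) (invariance_filter G)"
    and "b > 0"
  shows "\<exists>w'. eventually (\<lambda>F. p (\<psi> F - average G \<pi> F w') < b) (invariance_filter G)
    \<and> p (w' - w) < a + b"
proof -
  have "eventually (\<lambda>F. F \<in> fin_sets G \<and> p (average G \<pi> F (v - w)) < a + b) (invariance_filter G)"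
    using w v eventually_fin_sets[OF is_group]
  proof eventually_elim
    case (elim F)
    have "average G \<pi> F (v - w) = (\<psi> F - average G \<pi> F w) - (\<psi> F - average G \<pi> F v)"
      by (simp add: average_diff[OF elim(3)])
    then show ?case
      using seminorm_diff_le[OF seminorm, of "\<psi> F - average G \<pi> F w" "\<psi> F - average G \<pi> F v"]
        elim \<open>b > 0\<close> by simp
  qed
  then obtain E where E: "E \<in> fin_sets G" "p (average G \<pi> E (v - w)) < a + b"
    using eventually_happens'[OF nontrivial] by blast
  define u where "u = v - w"
  define w' where "w' = w + average G \<pi> E u"
  have "eventually (\<lambda>F. p (average G \<pi> F (u - average G \<pi> E u)) < b / 2) (invariance_filter G)"
    using average_minus_average_tendsto_0[OF E(1)] by (rule order_tendstoD) (use \<open>b > 0\<close> in simp)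
  with v eventually_fin_sets[OF is_group]
  have "eventually (\<lambda>F. p (\<psi> F - average G \<pi> F w') < b) (invariance_filter G)"
  proof eventually_elim
    case (elim F)
    have "u - average G \<pi> E u = v - w'"
      by (simp add: u_def w'_def)
    then have "p (average G \<pi> F v - average G \<pi> F w') < b / 2"
      using elim(3) by (simp add: average_diff[OF elim(2)])
    then show ?case
      using elim(1)
        seminorm_triangle_diff[OF seminorm, of "\<psi> F" "average G \<pi> F w'" "average G \<pi> F v"]
      by simp
  qed
  moreover have "p (w' - w) < a + b"
    using E(2) by (simp add: w'_def u_def)
  ultimately show ?thesis by blast
qed

text \<open>In the sequence below the \<open>n\<close>-th vector has eventual error less than \<open>2\<^sup>-\<^sup>n\<close>, and correcting
  it costs a step of the same order, so the steps are summable.\<close>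

lemma exists_exact_approximation:
  fixes \<psi> :: "'g set \<Rightarrow> 'v"
  assumes nontrivial: "invariance_filter G \<noteq> bot"
    and complete: "complete_seminorm p"
    and approx: "\<And>\<epsilon>. \<epsilon> > 0 \<Longrightarrow>
      \<exists>v. eventually (\<lambda>F. p (\<psi> F - average G \<pi> F v) < \<epsilon>) (invariance_filter G)"
  shows "\<exists>v. ((\<lambda>F. p (\<psi> F - average G \<pi> F v)) \<longlongrightarrow> 0) (invariance_filter G)"
proof -
  let ?good = "\<lambda>n w. eventually (\<lambda>F. p (\<psi> F - average G \<pi> F w) < (1/2)^n) (invariance_filter G)"
  have "\<exists>w. \<forall>n. ?good n (w n) \<and> p (w (Suc n) - w n) < 2 * (1/2)^n"
  proof (rule dependent_nat_choice)
    show "\<exists>w. ?good 0 w" using approx[of 1] by simp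
  next
    fix w n assume w: "?good n w"
    obtain v where
      "eventually (\<lambda>F. p (\<psi> F - average G \<pi> F v) < (1/2)^Suc n / 2) (invariance_filter G)"
      using approx[of "(1/2)^Suc n / 2"] by auto
    from nearby_better_approximation[OF nontrivial w this]
    obtain w' where w': "?good (Suc n) w'" "p (w' - w) < (1/2)^n + (1/2)^Suc n"
      by auto
    have "(1/2)^n + (1/2)^Suc n \<le> 2 * (1/2::real)^n"
      by simp
    with w' show "\<exists>w'. ?good (Suc n) w' \<and> p (w' - w) < 2 * (1/2)^n"
      by (meson less_le_trans)
  qed
  then obtain w where good: "\<And>n. ?good n (w n)"
    and step: "\<And>n. p (w (Suc n) - w n) < 2 * (1/2)^n"
    by blast
  \<comment> \<open>The right-hand side is the geometric sum of the steps, in closed form.\<close>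
  have tail: "p (w (n + k) - w n) \<le> 4 * (1/2)^n - 4 * (1/2)^(n + k)" for n k
  proof (induction k)
    case 0
    then show ?case by (simp add: seminorm_zero[OF seminorm])
  next
    case (Suc k)
    then show ?case
      using seminorm_triangle_diff[OF seminorm, of "w (n + Suc k)" "w n" "w (n + k)"]
        step[of "n + k"] by simp
  qed
  have tail_less: "p (w m - w n) < 4 * (1/2)^n" if "m \<ge> n" for m n
  proof -
    have "p (w m - w n) \<le> 4 * (1/2)^n - 4 * (1/2)^m"
      using tail[of n "m - n"] that by simp
    also have "\<dots> < 4 * (1/2)^n" by simp
    finally show ?thesis .
  qed
  have "\<exists>N. \<forall>m\<ge>N. \<forall>n\<ge>N. p (w m - w n) < \<epsilon>" if \<epsilon>: "\<epsilon> > 0" for \<epsilon>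
  proof -
    obtain N where N: "(1/2::real)^N < \<epsilon> / 8"
      using real_arch_pow_inv[of "\<epsilon> / 8" "1/2"] \<epsilon> by auto
    have "p (w m - w n) < \<epsilon>" if "m \<ge> N" "n \<ge> N" for m n
      using seminorm_triangle_diff[OF seminorm, of "w m" "w n" "w N"]
        seminorm_minus_commute[OF seminorm, of "w N" "w n"]
        tail_less[OF that(1)] tail_less[OF that(2)] N by linarith
    then show ?thesis by blast
  qed
  then obtain x where x: "(\<lambda>n. p (w n - x)) \<longlonglongrightarrow> 0"
    using complete unfolding complete_seminorm_def by meson
  have lim: "(\<lambda>n. (1/2)^n + C * p (w n - x)) \<longlonglongrightarrow> 0"
    by (intro tendsto_add_zero tendsto_mult_right_zero x LIMSEQ_power_zero) simp
  have "eventually (\<lambda>F. p (\<psi> F - average G \<pi> F x) < \<epsilon>) (invariance_filter G)"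
    if \<epsilon>: "\<epsilon> > 0" for \<epsilon>
  proof -
    obtain n where n: "(1/2)^n + C * p (w n - x) < \<epsilon>"
      using order_tendstoD(2)[OF lim \<epsilon>] eventually_happens'[OF sequentially_bot] by blast
    show ?thesis
      using good[of n] eventually_fin_sets[OF is_group]
    proof eventually_elim
      case (elim F)
      then show ?case
        using seminorm_triangle_diff[OF seminorm, of "\<psi> F" "average G \<pi> F x" "average G \<pi> F (w n)"]
          seminorm_average_le[OF elim(2), of "w n - x"] n
        by (simp add: average_diff[OF elim(2)])
    qed
  qed
  then have "((\<lambda>F. p (\<psi> F - average G \<pi> F x)) \<longlongrightarrow> 0) (invariance_filter G)"
    by (simp add: tendsto_iff seminorm_nonneg[OF seminorm])
  then show ?thesis by blast
qed

end

theorem corollary1: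
  fixes G :: "('g, 'm) monoid_scheme"
    and p :: "'v::real_vector \<Rightarrow> real"
    and \<pi> :: "'g \<Rightarrow> 'v \<Rightarrow> 'v"
    and \<phi> :: "'g set \<Rightarrow> 'v"
  assumes "group G" and "countable (carrier G)" and "amenable G"
    and "seminorm p" and "complete_seminorm p"
    and "is_representation G p \<pi>" and "uniformly_bounded G p \<pi>"
    and "\<phi> \<in> set_maps G p \<pi>"
    and "(INF v. limsup_along G (\<lambda>F. p ((1 / real (card F)) *\<^sub>R \<phi> F - average G \<pi> F v))) = 0"
  shows "\<exists>v. tends_along G (\<lambda>F. p ((1 / real (card F)) *\<^sub>R \<phi> F - average G \<pi> F v)) 0"
proof -
  interpret group G by (fact assms(1))
  obtain C where C: "C \<ge> 0" "\<And>g v. g \<in> carrier G \<Longrightarrow> p (\<pi> g v) \<le> C * p v"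
    using uniformly_bounded_obtain[OF assms(4,6,7)] by blast
  interpret bounded_representation G p \<pi> C
  proof (intro bounded_representation.intro is_group bounded_representation_axioms.intro)
    show "linear (\<pi> g)" if "g \<in> carrier G" for g
      using assms(6) that by (auto simp: is_representation_def hom_def Isom_def bounded_op_def)
    show "\<pi> (g \<otimes>\<^bsub>G\<^esub> h) v = \<pi> g (\<pi> h v)" if "g \<in> carrier G" "h \<in> carrier G" for g h v
      using hom_mult[OF assms(6)[unfolded is_representation_def] that] by (simp add: Isom_def)
  qed (use assms(4) C in auto)
  have "\<exists>v. eventually (\<lambda>F. p ((1 / real (card F)) *\<^sub>R \<phi> F - average G \<pi> F v) < \<epsilon>)
      (invariance_filter G)" if "\<epsilon> > 0" for \<epsilon>
  proof -
    have "(INF v. limsup_along G (\<lambda>F. p ((1 / real (card F)) *\<^sub>R \<phi> F - average G \<pi> F v))) < ereal \<epsilon>"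
      using assms(9) that by simp
    then show ?thesis
      unfolding INF_less_iff using limsup_along_less_imp_eventually[OF assms(1)] by blast
  qed
  from exists_exact_approximation[OF invariance_filter_neq_bot[OF assms(1,3)] assms(5) this]
  show ?thesis
    by (simp add: tends_along_iff_tendsto[OF assms(1)])
qed

end
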